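(* For all $n\in\mathbb{N}$, $\mu(n)\geq f(n)$.
   Context: $\mathbb{N}=\{1,2,3,\ldots\}$ and $\mathbb{N}_0=\{0,1,2,\ldots\}$. Let $T\subseteq\mathbb{N}_0^2$ be the additive monoid consisting of all finite linear combinations with coefficients in $\mathbb{N}_0$ of the vectors $z_i=\left(i,\binom{i}{2}\right)$, $i\in\mathbb{N}_0$, where $\binom{i}{2}=\frac{i(i-1)}{2}$. For $n\in\mathbb{N}_0$, $\mu(n):=\min\{m\in\mathbb{N}_0 : (m,n)\in T\}$. The function $f$ is given by $f(x)=\frac{1+\sqrt{8x+1}}{2}$. *)

theory Defs
  imports Complex_Main "HOL-Library.Product_Plus"
begin

definition zvec :: "nat \<Rightarrow> nat \<times> nat" where
  "zvec i = (i, i choose 2)"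

definition scale :: "nat \<Rightarrow> nat \<times> nat \<Rightarrow> nat \<times> nat" where
  "scale c v = (c * fst v, c * snd v)"

definition T :: "(nat \<times> nat) set" where
  "T = {(\<Sum>i\<in>I. scale (c i) (zvec i)) | (I :: nat set) (c :: nat \<Rightarrow> nat). finite I}"

definition mu :: "nat \<Rightarrow> nat" where
  "mu n = (LEAST m. (m, n) \<in> T)"

definition f :: "real \<Rightarrow> real" where
  "f x = (1 + sqrt (8 * x + 1)) / 2"

text \<open>The minimum defining \<^term>\<open>mu\<close> always exists: \<open>n\<close> copies of \<open>zvec 2 = (2, 1)\<close>
  sum to \<open>(2 * n, n)\<close>.\<close>

lemma two_n_n_in_T: "(2 * n, n) \<in> T"
proof -
  have "(2 * n, n) = (\<Sum>i\<in>{2}. scale n (zvec i))"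
    by (simp add: scale_def zvec_def)
  then show ?thesis
    unfolding T_def
    by (intro CollectI exI[of _ "{2}"] exI[of _ "\<lambda>_. n"]) simp
qed

lemma mu_in_T: "(mu n, n) \<in> T"
  unfolding mu_def by (rule LeastI) (rule two_n_n_in_T)

end

theory Submission
  imports Defs
begin

text \<open>Every \<open>(m, n) \<in> T\<close> satisfies \<open>n \<le> m (m - 1) / 2\<close>: the generators attain equality and the
  binomial coefficient is superadditive. Solving the quadratic inequality for \<open>m\<close> gives \<open>f n \<le> m\<close>.\<close>

text \<open>The additive form avoids both division and truncated subtraction on naturals.\<close>

lemma two_choose_two: "2 * (i choose 2) + i = i\<^sup>2"
  by (induction i) (auto simp: numeral_2_eq_2)

text \<open>The left side grows linearly in \<open>c\<close>, the right side quadratically, and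
  \<open>c \<le> c\<^sup>2\<close> for natural \<open>c\<close>.\<close>

lemma scale_quadratic_bound:
  assumes "2 * snd v + fst v \<le> (fst v)\<^sup>2"
  shows "2 * snd (scale c v) + fst (scale c v) \<le> (fst (scale c v))\<^sup>2"
proof -
  have "2 * snd (scale c v) + fst (scale c v) = c * (2 * snd v + fst v)"
    by (simp add: scale_def algebra_simps)
  also have "\<dots> \<le> c\<^sup>2 * (fst v)\<^sup>2"
    using assms by (intro mult_mono) (auto simp: power2_eq_square)
  finally show ?thesis
    by (simp add: scale_def power_mult_distrib)
qed

lemma T_quadratic_bound:
  assumes "(m, n) \<in> T"
  shows "2 * n + m \<le> m\<^sup>2"
proof -
  obtain I c where fin: "finite I" and mn: "(m, n) = (\<Sum>i\<in>I. scale (c i) (zvec i))"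
    using assms by (auto simp: T_def)
  let ?s = "\<lambda>I. \<Sum>i\<in>I. scale (c i) (zvec i)"
  have "2 * snd (?s I) + fst (?s I) \<le> (fst (?s I))\<^sup>2"
    using fin
  proof (induction I rule: finite_induct)
    case empty
    then show ?case by simp
  next
    case (insert j J)
    have "2 * snd (scale (c j) (zvec j)) + fst (scale (c j) (zvec j)) \<le> (fst (scale (c j) (zvec j)))\<^sup>2"
      by (rule scale_quadratic_bound) (simp add: zvec_def two_choose_two)
    \<comment> \<open>Expanding the square of the sum leaves a nonnegative cross term, so the two
      bounds add up.\<close>
    with insert show ?case
      by (simp add: power2_sum)
  qed
  then show ?thesis
    by (simp flip: mn)
qed

theorem theorem6p3:
  fixes n :: nat
  assumes "n \<ge> 1"
  shows "real (mu n) \<ge> f (real n)"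
proof -
  define m where "m = mu n"
  have bound: "2 * n + m \<le> m\<^sup>2"
    unfolding m_def by (rule T_quadratic_bound) (rule mu_in_T)
  \<comment> \<open>For \<open>m = 0\<close> the bound would force \<open>n = 0\<close>.\<close>
  with assms have "m \<ge> 1"
    by (cases m) auto
  have "real (2 * n + m) \<le> real (m\<^sup>2)"
    using bound by (rule of_nat_mono)
  \<comment> \<open>Multiply by 4 and complete the square.\<close>
  then have "8 * real n + 1 \<le> (2 * real m - 1)\<^sup>2"
    by (simp add: power2_eq_square algebra_simps)
  \<comment> \<open>Taking roots needs \<open>2 * real m - 1\<close> nonnegative, hence
    \<open>m \<ge> 1\<close>.\<close>
  then have "sqrt (8 * real n + 1) \<le> 2 * real m - 1"
    using \<open>m \<ge> 1\<close> by (intro real_le_lsqrt) auto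
  then show ?thesis
    by (simp add: f_def m_def)
qed

end
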